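(* Let $\mathcal{M}=\mathbb{Z}[x_1,\ldots,x_n]^m$ with $m>0$, let $\mathcal{N}\subseteq\mathcal{M}$ be a submodule, let $B=\{P_1,\ldots,P_r\}$ be the set of minimal associated primes of $\mathcal{N}$, and let $S=\{s_1,\ldots,s_r\}$ be a system of separators for $B$. For each $i$ let $$Q_i=\mathcal{N}:s_i^{\infty}=\mathcal{N}:s_i^{k_i},$$ where $k_i$ is a non-negative integer for which the second equality holds. Then each $Q_i$ is a pseudo-primary submodule of $\mathcal{M}$ and $$\mathcal{N}=Q_1\cap\ldots\cap Q_r\cap\left(\mathcal{N}+\langle s_1^{k_1},\ldots,s_r^{k_r}\rangle\mathcal{M}\right).$$
   Context: Write $\mathbb{Z}[x]=\mathbb{Z}[x_1,\ldots,x_n]$. For a submodule $\mathcal{N}\subseteq\mathcal{M}$, $\operatorname{Ann}(\mathcal{M}/\mathcal{N})=\{f\in\mathbb{Z}[x] : f\mathcal{M}\subseteq\mathcal{N}\}$. The minimal associated primes of $\mathcal{N}$ are the minimal associated primes of the ideal $\operatorname{Ann}(\mathcal{M}/\mathcal{N})$, i.e. the prime ideals of $\mathbb{Z}[x]$ minimal over it. A system of separators for $B=\{P_1,\ldots,P_r\}$ is a set $S=\{s_1,\ldots,s_r\}\subset\mathbb{Z}[x]$ such that $s_i\notin P_i$ for all $i$, and $s_i\in P_j$ for all $j\neq i$. For $s\in\mathbb{Z}[x]$ and an integer $k\ge 0$, $\mathcal{N}:s^k=\{v\in\mathcal{M} : s^k v\in\mathcal{N}\}$ and $\mathcal{N}:s^\infty=\bigcup_{k\ge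 0}(\mathcal{N}:s^k)$. An ideal $I$ of $\mathbb{Z}[x]$ is pseudo-primary if $\sqrt{I}$ is a prime ideal. A submodule $\mathcal{N}\subset\mathcal{M}$ is pseudo-primary if $\operatorname{Ann}(\mathcal{M}/\mathcal{N})$ is a pseudo-primary ideal of $\mathbb{Z}[x]$. *)

theory Defs
  imports "HOL-Algebra.Algebra" "HOL-Library.Poly_Mapping"
begin

(* Z[x_1, ..., x_n].  A monomial is a finitely supported exponent vector nat =>0 nat, a
   polynomial a finitely supported map from monomials to integer coefficients; addition and
   multiplication (convolution) are those of Poly_Mapping.  The carrier consists of the
   polynomials in which only the variables with index in {1..n} occur. *)
type_synonym int_mpoly = "(nat \<Rightarrow>\<^sub>0 nat) \<Rightarrow>\<^sub>0 int"

definition int_mpoly_ring :: "nat \<Rightarrow> int_mpoly ring" where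
  "int_mpoly_ring n =
    \<lparr>carrier = {p. \<forall>t \<in> Poly_Mapping.keys p. Poly_Mapping.keys t \<subseteq> {1..n}},
     monoid.mult = (*), one = 1, ring.zero = 0, ring.add = (+)\<rparr>"

(* The free module R^m, with tuples indexed by {1..m} and componentwise operations.  The
   fields mult and one belong to the record type but play no role for modules. *)
definition free_module :: "('a, 'c) ring_scheme \<Rightarrow> nat \<Rightarrow> ('a, nat \<Rightarrow> 'a) module" where
  "free_module R m =
    \<lparr>carrier = {1..m} \<rightarrow>\<^sub>E carrier R,
     monoid.mult = undefined, one = undefined,
     ring.zero = (\<lambda>i\<in>{1..m}. \<zero>\<^bsub>R\<^esub>),
     ring.add = (\<lambda>v w. \<lambda>i\<in>{1..m}. v i \<oplus>\<^bsub>R\<^esub> w i),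
     module.smult = (\<lambda>a v. \<lambda>i\<in>{1..m}. a \<otimes>\<^bsub>R\<^esub> v i)\<rparr>"

lemma cring_int_mpoly_ring: "cring (int_mpoly_ring n)"
proof (rule cringI)
  have keys_minus: "Poly_Mapping.keys (- p) = Poly_Mapping.keys p" for p :: int_mpoly
    by (auto simp: in_keys_iff)
  show "abelian_group (int_mpoly_ring n)"
  proof (rule abelian_groupI)
    fix p q assume "p \<in> carrier (int_mpoly_ring n)" "q \<in> carrier (int_mpoly_ring n)"
    then show "p \<oplus>\<^bsub>int_mpoly_ring n\<^esub> q \<in> carrier (int_mpoly_ring n)"
      using Poly_Mapping.keys_add[of p q] by (auto simp: int_mpoly_ring_def)
  next
    fix p assume "p \<in> carrier (int_mpoly_ring n)"
    then show "\<exists>q\<in>carrier (int_mpoly_ring n).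
        q \<oplus>\<^bsub>int_mpoly_ring n\<^esub> p = \<zero>\<^bsub>int_mpoly_ring n\<^esub>"
      by (intro bexI[of _ "- p"]) (auto simp: int_mpoly_ring_def keys_minus)
  qed (auto simp: int_mpoly_ring_def add_ac)
  have closed: "p * q \<in> carrier (int_mpoly_ring n)"
    if "p \<in> carrier (int_mpoly_ring n)" "q \<in> carrier (int_mpoly_ring n)" for p q
  proof -
    have "Poly_Mapping.keys t \<subseteq> {1..n}" if t: "t \<in> Poly_Mapping.keys (p * q)" for t
    proof -
      obtain a b where "t = a + b" "a \<in> Poly_Mapping.keys p" "b \<in> Poly_Mapping.keys q"
        using t Poly_Mapping.keys_mult[of p q] by blast
      then show ?thesis
        using \<open>p \<in> _\<close> \<open>q \<in> _\<close> Poly_Mapping.keys_add[of a b]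
        by (fastforce simp: int_mpoly_ring_def)
    qed
    then show ?thesis by (simp add: int_mpoly_ring_def)
  qed
  show "comm_monoid (int_mpoly_ring n)"
  proof (rule comm_monoidI)
    fix p q assume "p \<in> carrier (int_mpoly_ring n)" "q \<in> carrier (int_mpoly_ring n)"
    then show "p \<otimes>\<^bsub>int_mpoly_ring n\<^esub> q \<in> carrier (int_mpoly_ring n)"
      using closed[of p q] by (simp add: int_mpoly_ring_def)
  qed (simp_all add: int_mpoly_ring_def mult.assoc mult.commute)
qed (simp add: int_mpoly_ring_def distrib_right)

lemma module_free_module:
  assumes "cring R"
  shows "module R (free_module R m)"
proof -
  interpret cring R by fact
  note simps = free_module_def PiE_iff fun_eq_iff restrict_def extensional_def
  show ?thesis
  proof (rule moduleI)
    show "abelian_group (free_module R m)"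
    proof (rule abelian_groupI)
      fix v assume v: "v \<in> carrier (free_module R m)"
      show "\<exists>w\<in>carrier (free_module R m).
          w \<oplus>\<^bsub>free_module R m\<^esub> v = \<zero>\<^bsub>free_module R m\<^esub>"
        using v by (intro bexI[of _ "\<lambda>i\<in>{1..m}. \<ominus>\<^bsub>R\<^esub> v i"]) (auto simp: simps l_neg)
    qed (auto simp: simps a_ac)
  qed (use \<open>cring R\<close> in \<open>auto simp: simps l_distr r_distr m_assoc\<close>)
qed

(* Ann(M/N) *)
definition annihilator ::
    "('a, 'c) ring_scheme \<Rightarrow> ('a, 'b, 'd) module_scheme \<Rightarrow> 'b set \<Rightarrow> 'a set" where
  "annihilator R M N = {f \<in> carrier R. \<forall>v \<in> carrier M. f \<odot>\<^bsub>M\<^esub> v \<in> N}"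

definition minimal_primes :: "('a, 'c) ring_scheme \<Rightarrow> 'a set \<Rightarrow> 'a set set" where
  "minimal_primes R I = {P. primeideal P R \<and> I \<subseteq> P \<and>
     (\<forall>P'. primeideal P' R \<and> I \<subseteq> P' \<and> P' \<subseteq> P \<longrightarrow> P' = P)}"

definition minimal_associated_primes ::
    "('a, 'c) ring_scheme \<Rightarrow> ('a, 'b, 'd) module_scheme \<Rightarrow> 'b set \<Rightarrow> 'a set set" where
  "minimal_associated_primes R M N = minimal_primes R (annihilator R M N)"

definition system_of_separators ::
    "('a, 'c) ring_scheme \<Rightarrow> nat \<Rightarrow> (nat \<Rightarrow> 'a set) \<Rightarrow> (nat \<Rightarrow> 'a) \<Rightarrow> bool" where
  "system_of_separators R r P s \<longleftrightarrow>
     (\<forall>i\<in>{1..r}. s i \<in> carrier R \<and> s i \<notin> P i \<and> (\<forall>j\<in>{1..r}. j \<noteq> i \<longrightarrow> s i \<in> P j))"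

(* N : s^k *)
definition colon_power ::
    "('a, 'c) ring_scheme \<Rightarrow> ('a, 'b, 'd) module_scheme \<Rightarrow> 'b set \<Rightarrow> 'a \<Rightarrow> nat \<Rightarrow> 'b set" where
  "colon_power R M N s k = {v \<in> carrier M. (s [^]\<^bsub>R\<^esub> k) \<odot>\<^bsub>M\<^esub> v \<in> N}"

(* N : s^\<infinity> *)
definition saturation ::
    "('a, 'c) ring_scheme \<Rightarrow> ('a, 'b, 'd) module_scheme \<Rightarrow> 'b set \<Rightarrow> 'a \<Rightarrow> 'b set" where
  "saturation R M N s = (\<Union>k. colon_power R M N s k)"

definition radical :: "('a, 'c) ring_scheme \<Rightarrow> 'a set \<Rightarrow> 'a set" where
  "radical R I = {f \<in> carrier R. \<exists>k::nat. f [^]\<^bsub>R\<^esub> k \<in> I}"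

definition pseudo_primary_ideal :: "('a, 'c) ring_scheme \<Rightarrow> 'a set \<Rightarrow> bool" where
  "pseudo_primary_ideal R I \<longleftrightarrow> ideal I R \<and> primeideal (radical R I) R"

definition pseudo_primary_submodule ::
    "('a, 'c) ring_scheme \<Rightarrow> ('a, 'b, 'd) module_scheme \<Rightarrow> 'b set \<Rightarrow> bool" where
  "pseudo_primary_submodule R M N \<longleftrightarrow>
     submodule N R M \<and> pseudo_primary_ideal R (annihilator R M N)"

(* The submodule I M: all finite (nonempty) sums of products a v with a in I and v in M;
   the analogue for modules of the product of ideals ideal_prod. *)
inductive_set ideal_smult ::
    "('a, 'b, 'd) module_scheme \<Rightarrow> 'a set \<Rightarrow> 'b set" for M and I where
  smult: "a \<in> I \<Longrightarrow> v \<in> carrier M \<Longrightarrow> a \<odot>\<^bsub>M\<^esub> v \<in> ideal_smult M I"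
| add: "v \<in> ideal_smult M I \<Longrightarrow> w \<in> ideal_smult M I \<Longrightarrow> v \<oplus>\<^bsub>M\<^esub> w \<in> ideal_smult M I"

end

theory Submission
  imports Defs
begin

text \<open>
  The argument works for a module \<open>M\<close> over any commutative ring \<open>R\<close>, given finitely many minimal
  primes and saturations that are reached by a single power. It is carried out in that
  generality and then specialised to free modules over the integer polynomials.

  Everything rests on the fact that the radical of an ideal is the intersection of its minimal
  primes (\<open>radical_eq_Inter_minimal_primes\<close>), which takes two applications of Zorn's lemma.
  Write \<open>A = Ann (M / N)\<close>, and let \<open>P i\<close> be its minimal primes with separators \<open>s i\<close>.

  For pseudo-primarity, \<open>Ann (M / Q i)\<close> is \<open>A : s i [^] k i\<close>. An element \<open>f\<close> is in its radical iff
  \<open>f \<otimes> s i\<close> is in the radical of \<open>A\<close>, that is, in every \<open>P j\<close>. For \<open>j \<noteq> i\<close> this is automatic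
  since \<open>s i \<in> P j\<close>, and for \<open>j = i\<close> it means \<open>f \<in> P i\<close>. So the radical is the prime \<open>P i\<close>
  (\<open>radical_annihilator_colon_power\<close>).

  For the intersection, \<open>s i \<otimes> s j\<close> with \<open>i \<noteq> j\<close> lies in all the minimal primes, so that a power
  of it maps \<open>M\<close> into \<open>N\<close>. It follows that \<open>s i [^] k i\<close> maps \<open>M\<close> into \<open>Q j\<close>. If
  \<open>x \<oplus> (\<Sum>i. s i [^] k i \<odot> u i)\<close> with \<open>x \<in> N\<close> lies in \<open>Q j\<close>, then so does the single term
  \<open>s j [^] k j \<odot> u j\<close>; as \<open>Q j\<close> is saturated, \<open>u j \<in> Q j\<close>, which puts this term in \<open>N\<close>. Doing
  this for all \<open>j\<close> shows that the element is in \<open>N\<close> (\<open>submodule_eq_Inter_saturations\<close>).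
\<close>

section \<open>The radical of an ideal as an intersection of minimal primes\<close>

lemma set_add_memI: "h \<in> H \<Longrightarrow> k \<in> K \<Longrightarrow> h \<oplus>\<^bsub>G\<^esub> k \<in> H <+>\<^bsub>G\<^esub> K"
  unfolding set_add_def' by blast

context cring
begin

text \<open>The prime is an ideal \<open>P\<close> that is maximal among the ideals over \<open>I\<close> containing no power
  of \<open>f\<close>: if \<open>a\<close> and \<open>b\<close> are outside \<open>P\<close>, then \<open>P + (a)\<close> and \<open>P + (b)\<close> contain powers of \<open>f\<close>,
  hence so does \<open>P + (a \<otimes> b)\<close>, and \<open>a \<otimes> b\<close> is outside \<open>P\<close>.\<close>

lemma exists_primeideal_avoiding_powers:
  assumes I: "ideal I R" and f: "f \<in> carrier R"
    and avoid: "\<And>k::nat. f [^] k \<notin> I"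
  shows "\<exists>P. primeideal P R \<and> I \<subseteq> P \<and> f \<notin> P"
proof -
  define S where "S = {J. ideal J R \<and> I \<subseteq> J \<and> (\<forall>k::nat. f [^] k \<notin> J)}"
  have "\<exists>P\<in>S. \<forall>J\<in>S. P \<subseteq> J \<longrightarrow> J = P"
  proof (rule subset_Zorn_nonempty)
    show "S \<noteq> {}" using I avoid unfolding S_def by blast
  next
    fix C assume C: "C \<noteq> {}" "subset.chain S C"
    then have "subset.chain {I. ideal I R} C"
      unfolding pred_on.chain_def S_def by blast
    then have "ideal (\<Union>C) R"
      using chain_Union_is_ideal[of C] C(1) by simp
    then show "\<Union>C \<in> S"
      using C unfolding pred_on.chain_def S_def by blast
  qed
  then obtain P where "P \<in> S" and max: "\<And>J. J \<in> S \<Longrightarrow> P \<subseteq> J \<Longrightarrow> J = P"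
    by blast
  then have P: "ideal P R" "I \<subseteq> P" "\<And>k::nat. f [^] k \<notin> P"
    unfolding S_def by auto
  interpret P: ideal P R by fact
  have power: "\<exists>k::nat. \<exists>p\<in>P. \<exists>c\<in>carrier R. f [^] k = p \<oplus> c \<otimes> a"
    if a: "a \<in> carrier R" "a \<notin> P" for a
  proof -
    let ?J = "P <+>\<^bsub>R\<^esub> PIdl a"
    have ideal: "ideal ?J R"
      by (intro add_ideals P(1) cgenideal_ideal a(1))
    have "P \<subseteq> ?J"
    proof
      fix p assume "p \<in> P"
      then show "p \<in> ?J"
        using set_add_memI[of p P \<zero> "PIdl a" R] a(1) P.Icarr
          additive_subgroup.zero_closed[OF ideal.axioms(1)[OF cgenideal_ideal]] by simp
    qed
    moreover have "a \<in> ?J"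
      using set_add_memI[of \<zero> P a "PIdl a" R] a(1) cgenideal_self by simp
    ultimately have "?J \<notin> S"
      using max[of ?J] a(2) by blast
    then obtain k :: nat where "f [^] k \<in> ?J"
      using ideal \<open>P \<subseteq> ?J\<close> P(2) unfolding S_def by blast
    then show ?thesis
      unfolding set_add_def' cgenideal_def by blast
  qed
  have "primeideal P R"
  proof (rule primeidealI[OF P(1) is_cring])
    show "carrier R \<noteq> P" using P(3)[of 0] by auto
  next
    fix a b assume ab: "a \<in> carrier R" "b \<in> carrier R" "a \<otimes> b \<in> P"
    show "a \<in> P \<or> b \<in> P"
    proof (rule ccontr)
      assume "\<not> (a \<in> P \<or> b \<in> P)"
      then obtain k l :: nat and p q c d
        where k: "f [^] k = p \<oplus> c \<otimes> a" "p \<in> P" "c \<in> carrier R"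
          and l: "f [^] l = q \<oplus> d \<otimes> b" "q \<in> P" "d \<in> carrier R"
        using power[OF ab(1)] power[OF ab(2)] by blast
      have pq: "p \<in> carrier R" "q \<in> carrier R" using k l P.Icarr by auto
      have "f [^] (k + l) = (p \<oplus> c \<otimes> a) \<otimes> (q \<oplus> d \<otimes> b)"
        using f by (simp add: k(1) l(1) nat_pow_mult[symmetric])
      also have "\<dots> = (p \<otimes> (q \<oplus> d \<otimes> b) \<oplus> (c \<otimes> a) \<otimes> q) \<oplus> (c \<otimes> d) \<otimes> (a \<otimes> b)"
        using pq k(3) l(3) ab(1,2) by (simp add: l_distr r_distr m_ac a_ac)
      also have "\<dots> \<in> P"
      proof (intro P.a_closed)
        show "p \<otimes> (q \<oplus> d \<otimes> b) \<in> P"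
          using pq k(2) l(3) ab(2) by (intro P.I_r_closed) auto
        show "(c \<otimes> a) \<otimes> q \<in> P" "(c \<otimes> d) \<otimes> (a \<otimes> b) \<in> P"
          using k(3) l(2,3) ab by (auto intro: P.I_l_closed)
      qed
      finally show False using P(3) by blast
    qed
  qed
  moreover have "f \<notin> P" using P(3)[of 1] f by simp
  ultimately show ?thesis using P(2) by blast
qed

text \<open>A nonempty chain of primes has a prime intersection, so Zorn's lemma applies to the primes
  between \<open>I\<close> and \<open>P\<close>. Passing to complements turns minimal primes into maximal sets.\<close>

lemma exists_minimal_prime_below:
  assumes P: "primeideal P R" and IP: "I \<subseteq> P"
  shows "\<exists>P'\<in>minimal_primes R I. P' \<subseteq> P"
proof -
  define S where "S = {J. primeideal (- J) R \<and> I \<subseteq> - J \<and> - J \<subseteq> P}"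
  have "\<exists>J\<in>S. \<forall>J'\<in>S. J \<subseteq> J' \<longrightarrow> J' = J"
  proof (rule subset_Zorn_nonempty)
    have "- P \<in> S" unfolding S_def using P IP by simp
    then show "S \<noteq> {}" by blast
  next
    fix C assume C: "C \<noteq> {}" "subset.chain S C"
    let ?D = "uminus ` C"
    have prime: "primeideal J R" "I \<subseteq> J" "J \<subseteq> P" if "J \<in> ?D" for J
      using C(2) that unfolding pred_on.chain_def S_def by auto
    have total: "J \<subseteq> J' \<or> J' \<subseteq> J" if "J \<in> ?D" "J' \<in> ?D" for J J'
      using C(2) that unfolding pred_on.chain_def by auto
    have D: "- \<Union>C = \<Inter>?D" by auto
    have "ideal (\<Inter>?D) R"
      using C(1) by (intro i_Intersect) (auto intro: primeideal.axioms(1) prime)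
    have "primeideal (\<Inter>?D) R"
    proof (rule primeidealI[OF _ is_cring])
      show "ideal (\<Inter>?D) R" by fact
    next
      obtain J where "J \<in> ?D" using C(1) by blast
      then show "carrier R \<noteq> \<Inter>?D"
        using primeideal.I_notcarr[OF prime(1)] ideal.Icarr[OF primeideal.axioms(1)[OF prime(1)]]
        by (metis InterE subset_antisym subsetI)
    next
      fix a b assume ab: "a \<in> carrier R" "b \<in> carrier R" "a \<otimes> b \<in> \<Inter>?D"
      have "a \<in> J \<or> b \<in> J" if "J \<in> ?D" for J
        using primeideal.I_prime[OF prime(1)[OF that] ab(1,2)] ab(3) that by blast
      moreover have False if "J \<in> ?D" "J' \<in> ?D" "a \<notin> J" "b \<notin> J'" for J J'
        using calculation[OF that(1)] calculation[OF that(2)] total[OF that(1,2)] that(3,4) by blast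
      ultimately show "a \<in> \<Inter>?D \<or> b \<in> \<Inter>?D"
        by blast
    qed
    moreover have "I \<subseteq> \<Inter>?D"
      by (rule Inter_greatest) (rule prime(2))
    moreover have "\<Inter>?D \<subseteq> P"
    proof -
      obtain J where J: "J \<in> ?D" using C(1) by blast
      show ?thesis using Inter_lower[OF J] prime(3)[OF J] by (rule order_trans)
    qed
    ultimately show "\<Union>C \<in> S"
      unfolding S_def D by (simp add: D)
  qed
  then obtain J where J: "J \<in> S" and max: "\<And>J'. J' \<in> S \<Longrightarrow> J \<subseteq> J' \<Longrightarrow> J' = J"
    by blast
  have "P' = - J" if "primeideal P' R" "I \<subseteq> P'" "P' \<subseteq> - J" for P'
  proof -
    have "- P' \<in> S" using that J unfolding S_def by auto
    then show ?thesis using max[of "- P'"] that(3) by blast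
  qed
  then have "- J \<in> minimal_primes R I"
    using J unfolding S_def minimal_primes_def by blast
  then show ?thesis
    using J unfolding S_def by blast
qed

lemma primeideal_nat_pow_mem:
  assumes P: "primeideal P R" and f: "f \<in> carrier R" and pow: "f [^] (k::nat) \<in> P"
  shows "f \<in> P"
  using pow
proof (induction k)
  case 0
  then show ?case
    using ideal.one_imp_carrier[OF primeideal.axioms(1)[OF P]] primeideal.I_notcarr[OF P] by simp
next
  case (Suc k)
  then show ?case
    using primeideal.I_prime[OF P, of "f [^] k" f] f by auto
qed

theorem radical_eq_Inter_minimal_primes:
  assumes I: "ideal I R"
  shows "radical R I = {f \<in> carrier R. \<forall>P\<in>minimal_primes R I. f \<in> P}"
proof (intro equalityI subsetI)
  fix f assume "f \<in> radical R I"
  then obtain k :: nat where f: "f \<in> carrier R" "f [^] k \<in> I"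
    unfolding radical_def by blast
  have "f \<in> P" if "P \<in> minimal_primes R I" for P
    using that f primeideal_nat_pow_mem[of P f k] unfolding minimal_primes_def by blast
  then show "f \<in> {f \<in> carrier R. \<forall>P\<in>minimal_primes R I. f \<in> P}"
    using f(1) by blast
next
  fix f assume f: "f \<in> {f \<in> carrier R. \<forall>P\<in>minimal_primes R I. f \<in> P}"
  show "f \<in> radical R I"
  proof (rule ccontr)
    assume "f \<notin> radical R I"
    then have "f [^] k \<notin> I" for k :: nat
      using f unfolding radical_def by blast
    then obtain P where "primeideal P R" "I \<subseteq> P" "f \<notin> P"
      using exists_primeideal_avoiding_powers[OF I, of f] f by blast
    then show False
      using exists_minimal_prime_below[of P I] f by blast
  qed
qed

end


section \<open>Annihilators and saturations of submodules\<close>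

context module
begin

lemma submodule_zero_mem: "submodule H R M \<Longrightarrow> \<zero>\<^bsub>M\<^esub> \<in> H"
  using subgroup.one_closed[OF submodule.axioms(1)] by fastforce

lemma annihilator_ideal:
  assumes N: "submodule N R M"
  shows "ideal (annihilator R M N) R"
proof (rule idealI[OF R.ring_axioms])
  note NE = submoduleE[OF N] submodule_zero_mem[OF N]
  show "subgroup (annihilator R M N) (add_monoid R)"
  proof (rule R.add.subgroupI)
    show "annihilator R M N \<noteq> {}"
      using NE(7) unfolding annihilator_def by (auto intro!: exI[of _ \<zero>])
  qed (use NE in \<open>auto simp: annihilator_def smult_l_distr smult_l_minus simp flip: a_inv_def\<close>)
next
  fix a x assume "a \<in> annihilator R M N" "x \<in> carrier R"
  then show "x \<otimes> a \<in> annihilator R M N" and "a \<otimes> x \<in> annihilator R M N"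
    unfolding annihilator_def by (auto simp: smult_assoc1 submoduleE(4)[OF N])
qed

lemma submodule_colon_power:
  assumes N: "submodule N R M" and s: "s \<in> carrier R"
  shows "submodule (colon_power R M N s k) R M"
proof (rule submoduleI)
  note NE = submoduleE[OF N] submodule_zero_mem[OF N]
  show "colon_power R M N s k \<subseteq> carrier M"
    unfolding colon_power_def by blast
  show "\<zero>\<^bsub>M\<^esub> \<in> colon_power R M N s k"
    using s NE(7) unfolding colon_power_def by simp
  show "\<ominus>\<^bsub>M\<^esub> v \<in> colon_power R M N s k" if "v \<in> colon_power R M N s k" for v
    using that s NE(3) unfolding colon_power_def by (auto simp: smult_r_minus)
  show "v \<oplus>\<^bsub>M\<^esub> w \<in> colon_power R M N s k"
    if "v \<in> colon_power R M N s k" "w \<in> colon_power R M N s k" for v w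
    using that s NE(5) unfolding colon_power_def by (auto simp: smult_r_distr)
  show "a \<odot>\<^bsub>M\<^esub> v \<in> colon_power R M N s k"
    if a: "a \<in> carrier R" and v: "v \<in> colon_power R M N s k" for a v
  proof -
    have "(s [^] k) \<odot>\<^bsub>M\<^esub> (a \<odot>\<^bsub>M\<^esub> v) = a \<odot>\<^bsub>M\<^esub> ((s [^] k) \<odot>\<^bsub>M\<^esub> v)"
      using a v s unfolding colon_power_def by (auto simp: R.m_comm simp flip: smult_assoc1)
    then show ?thesis
      using a v NE(4) unfolding colon_power_def by auto
  qed
qed

lemma saturation_memI:
  assumes "v \<in> carrier M" "(s [^] (k::nat)) \<odot>\<^bsub>M\<^esub> v \<in> N"
  shows "v \<in> saturation R M N s"
  using assms unfolding saturation_def colon_power_def by blast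

lemma submodule_subset_saturation:
  assumes "submodule N R M"
  shows "N \<subseteq> saturation R M N s"
  using submoduleE(1)[OF assms] by (auto intro!: saturation_memI[where k = 0])

lemma saturation_idem:
  assumes s: "s \<in> carrier R" and v: "v \<in> carrier M"
    and sv: "(s [^] (k::nat)) \<odot>\<^bsub>M\<^esub> v \<in> saturation R M N s"
  shows "v \<in> saturation R M N s"
proof -
  obtain l :: nat where "(s [^] l) \<odot>\<^bsub>M\<^esub> ((s [^] k) \<odot>\<^bsub>M\<^esub> v) \<in> N"
    using sv unfolding saturation_def colon_power_def by blast
  then have "(s [^] (l + k)) \<odot>\<^bsub>M\<^esub> v \<in> N"
    using s v by (simp add: smult_assoc1 flip: R.nat_pow_mult)
  then show ?thesis
    by (rule saturation_memI[OF v])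
qed

text \<open>Since \<open>s\<close> lies in every minimal prime of \<open>Ann (M / N)\<close> except \<open>P\<close>, the product \<open>s \<otimes> f\<close>
  lies in all of them exactly when \<open>f\<close> lies in \<open>P\<close>. The hypothesis on \<open>k\<close> is what allows the
  exponent of \<open>s\<close> to be lowered to \<open>k\<close>.\<close>

lemma radical_annihilator_colon_power:
  assumes N: "submodule N R M"
    and P: "P \<in> minimal_associated_primes R M N"
    and s: "s \<in> carrier R" "s \<notin> P"
    and others: "\<And>P'. P' \<in> minimal_associated_primes R M N \<Longrightarrow> P' \<noteq> P \<Longrightarrow> s \<in> P'"
    and k: "saturation R M N s = colon_power R M N s k"
  shows "radical R (annihilator R M (colon_power R M N s k)) = P"
proof (intro equalityI subsetI)
  have prime: "primeideal P' R" "annihilator R M N \<subseteq> P'"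
    if "P' \<in> minimal_associated_primes R M N" for P'
    using that unfolding minimal_associated_primes_def minimal_primes_def by auto
  {
    fix f assume "f \<in> radical R (annihilator R M (colon_power R M N s k))"
    then obtain l :: nat where f: "f \<in> carrier R"
      and l: "f [^] l \<in> annihilator R M (colon_power R M N s k)"
      unfolding radical_def by blast
    have "(s [^] k) \<otimes> (f [^] l) \<in> annihilator R M N"
      using l f s(1) unfolding annihilator_def colon_power_def by (auto simp: smult_assoc1)
    then have "s [^] k \<in> P \<or> f [^] l \<in> P"
      using prime[OF P] f s(1) primeideal.I_prime[of P R "s [^] k" "f [^] l"] by auto
    then show "f \<in> P"
      using R.primeideal_nat_pow_mem[OF prime(1)[OF P]] f s by blast
  }
  {
    fix f assume fP: "f \<in> P"
    have f: "f \<in> carrier R"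
      using ideal.Icarr[OF primeideal.axioms(1)[OF prime(1)[OF P]] fP] .
    have "s \<otimes> f \<in> P'" if P': "P' \<in> minimal_associated_primes R M N" for P'
    proof -
      interpret ideal P' R by (rule primeideal.axioms(1)[OF prime(1)[OF P']])
      show ?thesis
        using others[OF P'] fP f s(1) I_l_closed I_r_closed by (cases "P' = P") auto
    qed
    then have "s \<otimes> f \<in> radical R (annihilator R M N)"
      using f s(1) R.radical_eq_Inter_minimal_primes[OF annihilator_ideal[OF N]]
      unfolding minimal_associated_primes_def by blast
    then obtain l :: nat where l: "(s \<otimes> f) [^] l \<in> annihilator R M N"
      unfolding radical_def by blast
    have "(f [^] l) \<odot>\<^bsub>M\<^esub> v \<in> saturation R M N s" if v: "v \<in> carrier M" for v
    proof (rule saturation_memI[where k = l])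
      show "(s [^] l) \<odot>\<^bsub>M\<^esub> ((f [^] l) \<odot>\<^bsub>M\<^esub> v) \<in> N"
        using l f s(1) v unfolding annihilator_def
        by (simp add: R.nat_pow_distrib flip: smult_assoc1)
    qed (use f v in simp)
    then show "f \<in> radical R (annihilator R M (colon_power R M N s k))"
      using f unfolding radical_def annihilator_def k by auto
  }
qed


section \<open>Splitting off the saturations\<close>

lemma finsum_submodule_mem:
  assumes H: "submodule H R M" and A: "finite A" and h: "\<And>i. i \<in> A \<Longrightarrow> h i \<in> H"
  shows "(\<Oplus>\<^bsub>M\<^esub>i\<in>A. h i) \<in> H"
  using A h
proof (induction A rule: finite_induct)
  case empty
  then show ?case using submodule_zero_mem[OF H] by simp
next
  case (insert i A)
  then have "h i \<in> carrier M" "h \<in> A \<rightarrow> carrier M"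
    using submoduleE(1)[OF H] by auto
  then show ?case
    using insert submoduleE(5)[OF H] by (simp add: M.finsum_insert)
qed

text \<open>The sums \<open>\<Sum>i\<in>A. a i \<odot> u i\<close> form a submodule \<open>W\<close>. The annihilator of \<open>M / W\<close> is an ideal
  that contains every \<open>a i\<close>, hence contains the ideal that they generate.\<close>

lemma ideal_smult_genideal_finite:
  assumes A: "finite A" and a: "\<And>i. i \<in> A \<Longrightarrow> a i \<in> carrier R"
    and w: "w \<in> ideal_smult M (Idl (a ` A))"
  obtains u where "\<And>i. i \<in> A \<Longrightarrow> u i \<in> carrier M" "w = (\<Oplus>\<^bsub>M\<^esub>i\<in>A. a i \<odot>\<^bsub>M\<^esub> u i)"
proof -
  define W where "W = {(\<Oplus>\<^bsub>M\<^esub>i\<in>A. a i \<odot>\<^bsub>M\<^esub> u i) | u. u \<in> A \<rightarrow> carrier M}"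
  have add: "v \<oplus>\<^bsub>M\<^esub> w \<in> W" if "v \<in> W" "w \<in> W" for v w
  proof -
    obtain u u' where u: "u \<in> A \<rightarrow> carrier M" "u' \<in> A \<rightarrow> carrier M"
      and vw: "v = (\<Oplus>\<^bsub>M\<^esub>i\<in>A. a i \<odot>\<^bsub>M\<^esub> u i)" "w = (\<Oplus>\<^bsub>M\<^esub>i\<in>A. a i \<odot>\<^bsub>M\<^esub> u' i)"
      using \<open>v \<in> W\<close> \<open>w \<in> W\<close> unfolding W_def by blast
    have "v \<oplus>\<^bsub>M\<^esub> w = (\<Oplus>\<^bsub>M\<^esub>i\<in>A. a i \<odot>\<^bsub>M\<^esub> u i \<oplus>\<^bsub>M\<^esub> a i \<odot>\<^bsub>M\<^esub> u' i)"
      unfolding vw using u a by (subst M.finsum_addf) auto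
    also have "\<dots> = (\<Oplus>\<^bsub>M\<^esub>i\<in>A. a i \<odot>\<^bsub>M\<^esub> (u i \<oplus>\<^bsub>M\<^esub> u' i))"
      using u a by (intro M.finsum_cong') (auto simp: smult_r_distr Pi_def)
    finally show ?thesis
      unfolding W_def using u by (auto intro!: exI[of _ "\<lambda>i. u i \<oplus>\<^bsub>M\<^esub> u' i"])
  qed
  have smult: "x \<odot>\<^bsub>M\<^esub> v \<in> W" if x: "x \<in> carrier R" and "v \<in> W" for x v
  proof -
    obtain u where u: "u \<in> A \<rightarrow> carrier M" and v: "v = (\<Oplus>\<^bsub>M\<^esub>i\<in>A. a i \<odot>\<^bsub>M\<^esub> u i)"
      using \<open>v \<in> W\<close> unfolding W_def by blast
    have "x \<odot>\<^bsub>M\<^esub> v = (\<Oplus>\<^bsub>M\<^esub>i\<in>A. x \<odot>\<^bsub>M\<^esub> (a i \<odot>\<^bsub>M\<^esub> u i))"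
      unfolding v using u a x A by (intro finsum_smult_ldistr) auto
    also have "\<dots> = (\<Oplus>\<^bsub>M\<^esub>i\<in>A. a i \<odot>\<^bsub>M\<^esub> (x \<odot>\<^bsub>M\<^esub> u i))"
      using u a x by (intro M.finsum_cong') (auto simp: Pi_def R.m_comm simp flip: smult_assoc1)
    finally show ?thesis
      unfolding W_def using u x by (auto intro!: exI[of _ "\<lambda>i. x \<odot>\<^bsub>M\<^esub> u i"])
  qed
  have carr: "W \<subseteq> carrier M"
    unfolding W_def using a by (auto intro!: M.finsum_closed)
  have single: "a j \<odot>\<^bsub>M\<^esub> v \<in> W" if j: "j \<in> A" and v: "v \<in> carrier M" for j v
  proof -
    have "(\<Oplus>\<^bsub>M\<^esub>i\<in>A. a i \<odot>\<^bsub>M\<^esub> (if j = i then v else \<zero>\<^bsub>M\<^esub>)) =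
        (\<Oplus>\<^bsub>M\<^esub>i\<in>A. if j = i then a i \<odot>\<^bsub>M\<^esub> v else \<zero>\<^bsub>M\<^esub>)"
      using a v by (intro M.finsum_cong') auto
    also have "\<dots> = a j \<odot>\<^bsub>M\<^esub> v"
      using j A a v by (intro M.add.finprod_singleton) auto
    finally show ?thesis
      unfolding W_def using v
      by (auto intro!: exI[of _ "\<lambda>i. if j = i then v else \<zero>\<^bsub>M\<^esub>"])
  qed
  have zero: "\<zero>\<^bsub>M\<^esub> \<in> W"
    unfolding W_def using a
    by (auto intro!: exI[of _ "\<lambda>i. \<zero>\<^bsub>M\<^esub>"] M.add.finprod_one_eqI[symmetric])
  have "submodule W R M"
  proof (rule submoduleI[OF carr zero _ add smult])
    fix v assume v: "v \<in> W"
    then have "\<ominus>\<^bsub>M\<^esub> v = (\<ominus> \<one>) \<odot>\<^bsub>M\<^esub> v"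
      using carr by (auto simp: smult_l_minus)
    then show "\<ominus>\<^bsub>M\<^esub> v \<in> W" using smult v by simp
  qed
  then have "Idl (a ` A) \<subseteq> annihilator R M W"
    using a single by (intro R.genideal_minimal annihilator_ideal) (auto simp: annihilator_def)
  with w have "w \<in> W"
    by induction (auto simp: annihilator_def add)
  then show ?thesis
    unfolding W_def using that by blast
qed

text \<open>The only condition on the \<open>s i\<close> besides the exponents is that their pairwise products are
  nilpotent modulo \<open>Ann (M / N)\<close>; this holds in particular for systems of separators.\<close>

theorem submodule_eq_Inter_saturations:
  assumes N: "submodule N R M" and A: "finite A"
    and s: "\<And>i. i \<in> A \<Longrightarrow> s i \<in> carrier R"
    and nilp: "\<And>i j. i \<in> A \<Longrightarrow> j \<in> A \<Longrightarrow> i \<noteq> j \<Longrightarrow> s i \<otimes> s j \<in> radical R (annihilator R M N)"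
    and k: "\<And>i. i \<in> A \<Longrightarrow> saturation R M N (s i) = colon_power R M N (s i) (k i)"
  shows "N = (\<Inter>i\<in>A. saturation R M N (s i)) \<inter>
    (N <+>\<^bsub>M\<^esub> ideal_smult M (Idl ((\<lambda>i. s i [^] k i) ` A)))" (is "N = ?Q \<inter> (N <+>\<^bsub>M\<^esub> ?IM)")
proof (intro equalityI subsetI)
  let ?I = "Idl ((\<lambda>i. s i [^] k i) ` A)"
  have I: "ideal ?I R"
    using s by (intro R.genideal_ideal) auto
  note NE = submoduleE[OF N]
  {
    fix v assume v: "v \<in> N"
    have "\<zero> \<odot>\<^bsub>M\<^esub> \<zero>\<^bsub>M\<^esub> \<in> ?IM"
      using additive_subgroup.zero_closed[OF ideal.axioms(1)[OF I]]
      by (intro ideal_smult.smult) auto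
    then have "v \<in> N <+>\<^bsub>M\<^esub> ?IM"
      using set_add_memI[of v N "\<zero>\<^bsub>M\<^esub>" ?IM M] v NE(1) by auto
    then show "v \<in> ?Q \<inter> (N <+>\<^bsub>M\<^esub> ?IM)"
      using v submodule_subset_saturation[OF N] by blast
  }
  {
    fix v assume v: "v \<in> ?Q \<inter> (N <+>\<^bsub>M\<^esub> ?IM)"
    then obtain x w where x: "x \<in> N" and w: "w \<in> ?IM" and vxw: "v = x \<oplus>\<^bsub>M\<^esub> w"
      unfolding set_add_def' by blast
    obtain u where u: "\<And>i. i \<in> A \<Longrightarrow> u i \<in> carrier M"
      and sum: "w = (\<Oplus>\<^bsub>M\<^esub>i\<in>A. (s i [^] k i) \<odot>\<^bsub>M\<^esub> u i)"
      using ideal_smult_genideal_finite[OF A _ w] s by blast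
    let ?t = "\<lambda>i. (s i [^] k i) \<odot>\<^bsub>M\<^esub> u i"
    have t: "?t i \<in> carrier M" if "i \<in> A" for i
      using that s u by simp
    have wM: "w \<in> carrier M"
      unfolding sum using t by (intro M.finsum_closed) auto
    have "?t j \<in> N" if j: "j \<in> A" for j
    proof -
      let ?Qj = "saturation R M N (s j)"
      have Qj: "submodule ?Qj R M"
        using submodule_colon_power[OF N] s j by (simp add: k)
      (* (s i \<otimes> s j) [^] l kills u i modulo N, so s j [^] l \<odot> u i lies in the saturation
         by s i, and there the exponent k i suffices. *)
      have other: "?t i \<in> ?Qj" if i: "i \<in> A - {j}" for i
      proof -
        from i j nilp[of i j] obtain l :: nat where l: "(s i \<otimes> s j) [^] l \<in> annihilator R M N"
          unfolding radical_def by auto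
        have "(s j [^] l) \<odot>\<^bsub>M\<^esub> u i \<in> saturation R M N (s i)"
        proof (rule saturation_memI[where k = l])
          show "(s i [^] l) \<odot>\<^bsub>M\<^esub> ((s j [^] l) \<odot>\<^bsub>M\<^esub> u i) \<in> N"
            using l i j s u unfolding annihilator_def
            by (simp add: R.nat_pow_distrib flip: smult_assoc1)
        qed (use i j s u in simp)
        then have "(s i [^] k i) \<odot>\<^bsub>M\<^esub> ((s j [^] l) \<odot>\<^bsub>M\<^esub> u i) \<in> N"
          using i k[of i] unfolding colon_power_def by auto
        moreover have "(s i [^] k i) \<odot>\<^bsub>M\<^esub> ((s j [^] l) \<odot>\<^bsub>M\<^esub> u i) = (s j [^] l) \<odot>\<^bsub>M\<^esub> ?t i"
          using i j s u by (simp add: R.m_comm flip: smult_assoc1)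
        ultimately show ?thesis
          using t[of i] i by (auto intro: saturation_memI)
      qed
      (* Hence the j-th term of v is the only one not yet known to lie in ?Qj. *)
      let ?y = "\<Oplus>\<^bsub>M\<^esub>i\<in>A - {j}. ?t i"
      have y: "?y \<in> ?Qj"
        using other A by (intro finsum_submodule_mem[OF Qj]) auto
      have yM: "?y \<in> carrier M" using y submoduleE(1)[OF Qj] by blast
      have xM: "x \<in> carrier M" using x NE(1) by blast
      have "w = (\<Oplus>\<^bsub>M\<^esub>i\<in>insert j (A - {j}). ?t i)"
        using j sum by (simp add: insert_absorb)
      also have "\<dots> = ?t j \<oplus>\<^bsub>M\<^esub> ?y"
        using A t j by (intro M.finsum_insert) auto
      finally have "v = x \<oplus>\<^bsub>M\<^esub> (?t j \<oplus>\<^bsub>M\<^esub> ?y)"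
        using vxw by simp
      then have "?t j = v \<oplus>\<^bsub>M\<^esub> (\<ominus>\<^bsub>M\<^esub> (x \<oplus>\<^bsub>M\<^esub> ?y))"
        using xM yM t[OF j] by (simp add: M.a_ac M.minus_add M.r_neg M.r_neg1 M.r_neg2)
      also have "\<dots> \<in> ?Qj"
        using v j x y submodule_subset_saturation[OF N]
        by (intro submoduleE(3,5)[OF Qj]) auto
      finally have "u j \<in> ?Qj"
        using saturation_idem s u j by blast
      then show ?thesis
        using k[OF j] unfolding colon_power_def by auto
    qed
    then have "w \<in> N"
      unfolding sum using A by (intro finsum_submodule_mem[OF N]) auto
    then show "v \<in> N"
      unfolding vxw using x NE(5) by blast
  }
qed

end


section \<open>The pseudo-primary decomposition\<close>

theorem lemma3p3:
  fixes n m r :: nat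
    and R :: "int_mpoly ring"
    and M :: "(int_mpoly, nat \<Rightarrow> int_mpoly) module"
    and N :: "(nat \<Rightarrow> int_mpoly) set"
    and P :: "nat \<Rightarrow> int_mpoly set"
    and s :: "nat \<Rightarrow> int_mpoly"
    and k :: "nat \<Rightarrow> nat"
    and Q :: "nat \<Rightarrow> (nat \<Rightarrow> int_mpoly) set"
  assumes R: "R = int_mpoly_ring n"
    and M: "M = free_module R m"
    and m: "m > 0"
    and N: "submodule N R M"
    and P: "P ` {1..r} = minimal_associated_primes R M N"
    and s: "system_of_separators R r P s"
    and Q: "\<And>i. i \<in> {1..r} \<Longrightarrow> Q i = saturation R M N (s i)"
    and k: "\<And>i. i \<in> {1..r} \<Longrightarrow> saturation R M N (s i) = colon_power R M N (s i) (k i)"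
  shows "(\<forall>i\<in>{1..r}. pseudo_primary_submodule R M (Q i)) \<and>
    N = (\<Inter>i\<in>{1..r}. Q i) \<inter>
        (N <+>\<^bsub>M\<^esub> ideal_smult M (Idl\<^bsub>R\<^esub> ((\<lambda>i. s i [^]\<^bsub>R\<^esub> k i) ` {1..r})))"
proof (intro conjI ballI)
  interpret R: cring R unfolding R by (rule cring_int_mpoly_ring)
  interpret module R M unfolding M by (rule module_free_module[OF R.is_cring])
  have s_carr: "s i \<in> carrier R" and s_notin: "s i \<notin> P i" if "i \<in> {1..r}" for i
    using s that unfolding system_of_separators_def by auto
  have s_in: "s i \<in> P j" if "i \<in> {1..r}" "j \<in> {1..r}" "i \<noteq> j" for i j
    using s that unfolding system_of_separators_def by auto
  have P_mem: "P i \<in> minimal_associated_primes R M N" if "i \<in> {1..r}" for i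
    using P that by blast
  have prime: "primeideal (P i) R" if "i \<in> {1..r}" for i
    using P_mem[OF that] unfolding minimal_associated_primes_def minimal_primes_def by blast
  {
    fix i assume i: "i \<in> {1..r}"
    have Qi: "Q i = colon_power R M N (s i) (k i)"
      using Q[OF i] k[OF i] by simp
    have "s i \<in> P'" if P': "P' \<in> minimal_associated_primes R M N" "P' \<noteq> P i" for P'
    proof -
      obtain j where "j \<in> {1..r}" "P' = P j" using P' P by blast
      then show ?thesis using s_in[OF i, of j] P'(2) by blast
    qed
    then have "radical R (annihilator R M (Q i)) = P i"
      unfolding Qi using i k
      by (intro radical_annihilator_colon_power N P_mem s_carr s_notin) auto
    moreover have "submodule (Q i) R M"
      unfolding Qi by (intro submodule_colon_power N s_carr i)
    ultimately show "pseudo_primary_submodule R M (Q i)"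
      unfolding pseudo_primary_submodule_def pseudo_primary_ideal_def
      using annihilator_ideal prime[OF i] by simp
  }
  have "s i \<otimes>\<^bsub>R\<^esub> s j \<in> radical R (annihilator R M N)"
    if ij: "i \<in> {1..r}" "j \<in> {1..r}" "i \<noteq> j" for i j
  proof -
    have "s i \<otimes>\<^bsub>R\<^esub> s j \<in> P l" if l: "l \<in> {1..r}" for l
    proof -
      interpret ideal "P l" R by (rule primeideal.axioms(1)[OF prime[OF l]])
      show ?thesis
        using ij l s_in[of i l] s_in[of j l] s_carr I_l_closed I_r_closed by (cases "i = l") auto
    qed
    then show ?thesis
      using ij s_carr R.radical_eq_Inter_minimal_primes[OF annihilator_ideal[OF N]]
      unfolding P[unfolded minimal_associated_primes_def, symmetric] by auto
  qed
  then show "N = (\<Inter>i\<in>{1..r}. Q i) \<inter>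
      (N <+>\<^bsub>M\<^esub> ideal_smult M (Idl\<^bsub>R\<^esub> ((\<lambda>i. s i [^]\<^bsub>R\<^esub> k i) ` {1..r})))"
    using submodule_eq_Inter_saturations[OF N, of "{1..r}" s k] s_carr k Q by simp
qed

end
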